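(* Let $G$ be a finite group and let $H$ be a normal subgroup of $G$. Then $w(\Gamma_H(G))=|H|(M-1)+1$, where $M=w(\Gamma(G/H))$.
   Context: For a finite group $G$ with identity $e$ and a normal subgroup $H$ of $G$, the normal subgroup based power graph $\Gamma_H(G)$ is the simple undirected graph with vertex set $V(\Gamma_H(G))=(G\setminus H)\cup\{e\}$, in which two distinct vertices $x,y$ are adjacent if and only if $xH=y^mH$ or $yH=x^nH$ for some $m,n\in\mathbb{N}$. Here $\mathbb{N}$ denotes the positive integers. For a finite group $K$, the (undirected) power graph $\Gamma(K)$ is the simple graph with vertex set $K$ in which two distinct elements $u,v$ are adjacent if and only if $u=v^m$ or $v=u^m$ for some positive integer $m$. The clique number $w(\Gamma)$ of a graph $\Gamma$ is the maximum size of a clique in $\Gamma$. *)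

theory Defs
  imports "HOL-Algebra.Coset" "Graph_Theory.Pair_Digraph"
begin

text \<open>Undirected simple graphs are symmetric loop-free arc relations, as in the locale
  \<^locale>\<open>pair_graph\<close>.\<close>

definition is_clique :: "'a pair_pre_digraph \<Rightarrow> 'a set \<Rightarrow> bool" where
  "is_clique \<Gamma> C \<longleftrightarrow>
     C \<subseteq> pverts \<Gamma> \<and> (\<forall>u\<in>C. \<forall>v\<in>C. u \<noteq> v \<longrightarrow> (u, v) \<in> parcs \<Gamma>)"

text \<open>Only meaningful for finite graphs. The empty set counts as a clique, so the maximum is
  taken over a nonempty set.\<close>

definition clique_number :: "'a pair_pre_digraph \<Rightarrow> nat" where
  "clique_number \<Gamma> = Max {card C | C. is_clique \<Gamma> C}"

definition power_graph :: "('a, 'b) monoid_scheme \<Rightarrow> 'a pair_pre_digraph" where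
  "power_graph K =
     \<lparr> pverts = carrier K,
       parcs = {(u, v). u \<in> carrier K \<and> v \<in> carrier K \<and> u \<noteq> v \<and>
         (\<exists>m::nat. m > 0 \<and> (u = v [^]\<^bsub>K\<^esub> m \<or> v = u [^]\<^bsub>K\<^esub> m))} \<rparr>"

definition nsb_verts :: "('a, 'b) monoid_scheme \<Rightarrow> 'a set \<Rightarrow> 'a set" where
  "nsb_verts G H = (carrier G - H) \<union> {\<one>\<^bsub>G\<^esub>}"

definition nsb_power_graph :: "('a, 'b) monoid_scheme \<Rightarrow> 'a set \<Rightarrow> 'a pair_pre_digraph" where
  "nsb_power_graph G H =
     \<lparr> pverts = nsb_verts G H,
       parcs = {(x, y). x \<in> nsb_verts G H \<and> y \<in> nsb_verts G H \<and> x \<noteq> y \<and>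
         ((\<exists>m::nat. m > 0 \<and> x <#\<^bsub>G\<^esub> H = (y [^]\<^bsub>G\<^esub> m) <#\<^bsub>G\<^esub> H) \<or>
          (\<exists>n::nat. n > 0 \<and> y <#\<^bsub>G\<^esub> H = (x [^]\<^bsub>G\<^esub> n) <#\<^bsub>G\<^esub> H))} \<rparr>"

lemma pair_graph_power_graph:
  assumes "finite (carrier K)"
  shows "pair_graph (power_graph K)"
proof
  show "finite (pverts (power_graph K))"
    using assms by (simp add: power_graph_def)
  show "finite (parcs (power_graph K))"
    by (rule finite_subset[of _ "carrier K \<times> carrier K"])
      (use assms in \<open>auto simp: power_graph_def\<close>)
  show "symmetric (with_proj (power_graph K))"
    by (auto simp: power_graph_def symmetric_def arcs_ends_def arc_to_ends_def intro!: symI)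
qed (auto simp: power_graph_def)

lemma pair_graph_nsb_power_graph:
  assumes "finite (carrier G)"
  shows "pair_graph (nsb_power_graph G H)"
proof
  have fin: "finite (nsb_verts G H)"
    using assms by (simp add: nsb_verts_def)
  then show "finite (pverts (nsb_power_graph G H))"
    by (simp add: nsb_power_graph_def)
  show "finite (parcs (nsb_power_graph G H))"
    by (rule finite_subset[of _ "nsb_verts G H \<times> nsb_verts G H"])
      (use fin in \<open>auto simp: nsb_power_graph_def\<close>)
  show "symmetric (with_proj (nsb_power_graph G H))"
    by (auto simp: nsb_power_graph_def symmetric_def arcs_ends_def arc_to_ends_def intro!: symI)
qed (auto simp: nsb_power_graph_def)

end

theory Submission
  imports Defs "HOL-Algebra.Multiplicative_Group"
begin

text \<open>The quotient map sends cliques of \<open>\<Gamma>\<^sub>H(G)\<close> to cliques of the power graph of \<open>G/H\<close>, and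
  preimages of cliques that avoid the coset \<open>H\<close> are cliques of \<open>\<Gamma>\<^sub>H(G)\<close>, since elements of one
  coset are adjacent.  The coset \<open>H\<close> is adjacent to every vertex and contributes only the vertex
  \<open>e\<close>; every other coset contributes all of its \<open>|H|\<close> elements.\<close>

lemma finite_clique_cards:
  assumes "finite (pverts \<Gamma>)"
  shows "finite {card C | C. is_clique \<Gamma> C}"
  by (rule finite_subset[of _ "card ` Pow (pverts \<Gamma>)"]) (use assms in \<open>auto simp: is_clique_def\<close>)

lemma card_clique_le_clique_number:
  assumes "finite (pverts \<Gamma>)" and "is_clique \<Gamma> C"
  shows "card C \<le> clique_number \<Gamma>"
  unfolding clique_number_def
  by (rule Max_ge[OF finite_clique_cards[OF assms(1)]]) (use assms(2) in blast)

text \<open>The empty clique makes the set of sizes nonempty, so \<open>Max\<close> is one of its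
  elements. Both bounds start from a clique of maximum size obtained here.\<close>

lemma clique_number_attained:
  assumes "finite (pverts \<Gamma>)"
  obtains C where "is_clique \<Gamma> C" and "card C = clique_number \<Gamma>"
proof -
  have "is_clique \<Gamma> {}"
    by (simp add: is_clique_def)
  then have "clique_number \<Gamma> \<in> {card C | C. is_clique \<Gamma> C}"
    unfolding clique_number_def by (intro Max_in finite_clique_cards[OF assms]) blast
  then show thesis
    using that by force
qed

text \<open>In a finite group the group order is a positive exponent that sends every element to
  \<open>\<one>\<close>, so \<open>\<one>\<close> is adjacent to all other elements. Applied to the
  quotient, this lets both bounds work with a clique containing the coset \<open>H\<close>.\<close>

lemma (in group) power_graph_clique_insert_one:
  assumes "finite (carrier G)" and "is_clique (power_graph G) C"
  shows "is_clique (power_graph G) (insert \<one> C)"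
proof -
  have "\<exists>m::nat. m > 0 \<and> \<one> = u [^] m" if "u \<in> carrier G" for u
    using that assms(1) pow_order_eq_1 order_gt_0_iff_finite by metis
  then show ?thesis
    using assms(2) unfolding is_clique_def power_graph_def by auto
qed

text \<open>Normality identifies left and right cosets, and the quotient map is a homomorphism. This
  links the left cosets defining the arcs of \<open>nsb_power_graph\<close> to the right cosets that
  make up \<open>G Mod H\<close>.\<close>

lemma (in normal) l_coset_pow_eq:
  assumes "x \<in> carrier G"
  shows "(x [^] (m::nat)) <# H = (H #> x) [^]\<^bsub>G Mod H\<^esub> m"
proof -
  have "group_hom G (G Mod H) (\<lambda>a. H #> a)"
    using r_coset_hom_Mod factorgroup_is_group is_group
    by (simp add: group_hom_def group_hom_axioms_def)
  then show ?thesis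
    using group_hom.hom_nat_pow[of G "G Mod H" "\<lambda>a. H #> a" x m] coset_eq assms by simp
qed

text \<open>Adjacency depends only on the cosets of the two vertices. Equal cosets form a separate
  case because \<open>power_graph\<close> has no loops.\<close>

lemma (in normal) nsb_power_graph_arc_iff:
  assumes "x \<in> nsb_verts G H" and "y \<in> nsb_verts G H"
  shows "(x, y) \<in> parcs (nsb_power_graph G H) \<longleftrightarrow>
    x \<noteq> y \<and> (H #> x = H #> y \<or> (H #> x, H #> y) \<in> parcs (power_graph (G Mod H)))"
proof -
  have xy: "x \<in> carrier G" "y \<in> carrier G"
    using assms by (auto simp: nsb_verts_def)
  have car: "H #> x \<in> carrier (G Mod H)" "H #> y \<in> carrier (G Mod H)"
    using xy subset by (auto simp: FactGroup_def intro: rcosetsI)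
  have lr: "x <# H = H #> x" "y <# H = H #> y"
    using coset_eq xy by auto
  \<comment> \<open>Exponent 1 shows that equal cosets satisfy the power condition.\<close>
  have one: "\<exists>m::nat. m > 0 \<and> H #> x = (H #> y) [^]\<^bsub>G Mod H\<^esub> m" if "H #> x = H #> y"
    using that monoid.nat_pow_eone[of "G Mod H" "H #> y"] car(2) factorgroup_is_group
    by (intro exI[of _ 1]) (simp add: group_def)
  have "(x, y) \<in> parcs (nsb_power_graph G H) \<longleftrightarrow> x \<noteq> y \<and>
      (\<exists>m::nat. m > 0 \<and> (H #> x = (H #> y) [^]\<^bsub>G Mod H\<^esub> m \<or> H #> y = (H #> x) [^]\<^bsub>G Mod H\<^esub> m))"
    using assms by (simp add: nsb_power_graph_def l_coset_pow_eq xy lr) blast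
  moreover have "(H #> x, H #> y) \<in> parcs (power_graph (G Mod H)) \<longleftrightarrow> H #> x \<noteq> H #> y \<and>
      (\<exists>m::nat. m > 0 \<and> (H #> x = (H #> y) [^]\<^bsub>G Mod H\<^esub> m \<or> H #> y = (H #> x) [^]\<^bsub>G Mod H\<^esub> m))"
    using car by (simp add: power_graph_def)
  ultimately show ?thesis
    using one by blast
qed

text \<open>Distinct cosets are disjoint and each is equinumerous with \<open>H\<close>.\<close>

lemma (in normal) card_Union_rcosets:
  assumes "finite (carrier G)" and "P \<subseteq> rcosets H"
  shows "card (\<Union>P) = card H * card P"
proof -
  have part: "\<Union>P \<subseteq> carrier G"
    using assms(2) rcosets_part_G[OF subgroup_axioms] by blast
  have "finite (rcosets H)"
    using rcosets_finite assms(1) by (simp add: RCOSETS_def)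
  moreover have "c1 \<inter> c2 = {}" if "c1 \<in> P" "c2 \<in> P" "c1 \<noteq> c2" for c1 c2
    using pairwiseD[OF rcos_disjoint[OF subgroup_axioms]] that assms(2)
    by (simp add: disjnt_def subset_iff)
  moreover have "card c = card H" if "c \<in> P" for c
    using that assms(2) by (intro card_rcosets_equal[OF _ subset, symmetric]) auto
  ultimately have "card H * card P = card (\<Union>P)"
    using finite_subset[OF assms(2)] finite_subset[OF part assms(1)]
    by (intro card_partition) simp_all
  then show ?thesis by simp
qed

lemma (in normal) card_Union_rcosets_Diff:
  assumes "finite (carrier G)" and "P \<subseteq> rcosets H" and "H \<in> P"
  shows "card (\<Union>(P - {H})) = card H * (card P - 1)"
proof -
  have "card (\<Union>(P - {H})) = card H * card (P - {H})"
    using assms by (intro card_Union_rcosets) auto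
  then show ?thesis
    using assms(3) by (simp add: card_Diff_singleton)
qed

lemma (in normal) r_coset_eq_subgroup_iff:
  assumes "x \<in> carrier G"
  shows "H #> x = H \<longleftrightarrow> x \<in> H"
  using coset_join1[OF _ assms subgroup_axioms] coset_join2[OF assms subgroup_axioms] by (rule iffI)

text \<open>A maximum clique is covered by \<open>\<one>\<close> and the cosets other than
  \<open>H\<close> that it meets; these cosets together with \<open>H\<close> form a clique of the
  quotient.\<close>

lemma (in normal) clique_number_nsb_power_graph_le:
  assumes "finite (carrier G)"
  shows "clique_number (nsb_power_graph G H)
    \<le> card H * (clique_number (power_graph (G Mod H)) - 1) + 1"
proof -
  interpret Q: group "G Mod H" by (rule factorgroup_is_group)
  have finQ: "finite (carrier (G Mod H))"
    using assms by (simp add: FactGroup_def RCOSETS_def)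
  obtain C where C: "is_clique (nsb_power_graph G H) C"
    "card C = clique_number (nsb_power_graph G H)"
    using clique_number_attained[of "nsb_power_graph G H"] assms
    by (auto simp: nsb_power_graph_def nsb_verts_def)
  have CV: "C \<subseteq> nsb_verts G H"
    using C(1) by (simp add: is_clique_def nsb_power_graph_def)
  then have CG: "C \<subseteq> carrier G"
    by (auto simp: nsb_verts_def)
  \<comment> \<open>Adjoining \<open>H\<close> ensures that \<open>P - {H}\<close> has exactly one
    coset fewer than \<open>P\<close>, even when \<open>C\<close> does not contain
    \<open>\<one>\<close>.\<close>
  define P where "P = insert H ((\<lambda>x. H #> x) ` C)"
  have "(H #> x, H #> y) \<in> parcs (power_graph (G Mod H))"
    if "x \<in> C" "y \<in> C" "H #> x \<noteq> H #> y" for x y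
  proof -
    have "x \<noteq> y"
      using that(3) by auto
    then have "(x, y) \<in> parcs (nsb_power_graph G H)"
      using that(1,2) C(1) unfolding is_clique_def by simp
    then show ?thesis
      using that CV nsb_power_graph_arc_iff[of x y] by (simp add: subset_iff)
  qed
  moreover have "(\<lambda>x. H #> x) ` C \<subseteq> pverts (power_graph (G Mod H))"
    using CG subset rcosetsI by (auto simp: power_graph_def FactGroup_def)
  ultimately have "is_clique (power_graph (G Mod H)) ((\<lambda>x. H #> x) ` C)"
    by (auto simp: is_clique_def)
  from Q.power_graph_clique_insert_one[OF finQ this]
  have P: "is_clique (power_graph (G Mod H)) P"
    by (simp add: P_def one_FactGroup)
  then have PM: "card P \<le> clique_number (power_graph (G Mod H))"
    using finQ by (intro card_clique_le_clique_number) (simp_all add: power_graph_def)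
  have PR: "P \<subseteq> rcosets H"
    using P by (simp add: is_clique_def power_graph_def FactGroup_def)
  \<comment> \<open>The only vertex inside \<open>H\<close> is \<open>\<one>\<close>; any other
    \<open>x\<close> lies in its own coset, which differs from \<open>H\<close>.\<close>
  have "C \<subseteq> insert \<one> (\<Union>(P - {H}))"
  proof
    fix x assume x: "x \<in> C"
    show "x \<in> insert \<one> (\<Union>(P - {H}))"
    proof (cases "x = \<one>")
      case False
      then have "x \<in> carrier G" "x \<notin> H"
        using x CV by (auto simp: nsb_verts_def)
      then show ?thesis
        using x rcos_self[of x] r_coset_eq_subgroup_iff[of x] subgroup_axioms
        unfolding P_def by blast
    qed simp
  qed
  moreover have finU: "finite (\<Union>(P - {H}))"
    using PR rcosets_part_G[OF subgroup_axioms] assms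
    by (metis Diff_subset Union_mono finite_subset)
  ultimately have "card C \<le> card (insert \<one> (\<Union>(P - {H})))"
    by (intro card_mono) auto
  also have "\<dots> \<le> card (\<Union>(P - {H})) + 1"
    by (simp add: card_insert_if finU)
  also have "card (\<Union>(P - {H})) = card H * (card P - 1)"
    using card_Union_rcosets_Diff[OF assms PR] by (simp add: P_def)
  also have "card H * (card P - 1) + 1
      \<le> card H * (clique_number (power_graph (G Mod H)) - 1) + 1"
    using PM by (simp add: diff_le_mono)
  finally show ?thesis
    using C(2) by simp
qed

lemma (in normal) clique_number_nsb_power_graph_ge:
  assumes "finite (carrier G)"
  shows "clique_number (nsb_power_graph G H)
    \<ge> card H * (clique_number (power_graph (G Mod H)) - 1) + 1"
proof -
  interpret Q: group "G Mod H" by (rule factorgroup_is_group)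
  have finQ: "finite (carrier (G Mod H))"
    using assms by (simp add: FactGroup_def RCOSETS_def)
  obtain K where K: "is_clique (power_graph (G Mod H)) K"
    "card K = clique_number (power_graph (G Mod H))"
    using clique_number_attained[of "power_graph (G Mod H)"] finQ
    by (auto simp: power_graph_def)
  define P where "P = insert H K"
  have P: "is_clique (power_graph (G Mod H)) P"
    using Q.power_graph_clique_insert_one[OF finQ K(1)] by (simp add: P_def one_FactGroup)
  have PR: "P \<subseteq> rcosets H"
    using P by (simp add: is_clique_def power_graph_def FactGroup_def)
  have finP: "finite P"
    using PR finQ by (auto simp: FactGroup_def intro: finite_subset)
  have cardP: "clique_number (power_graph (G Mod H)) \<le> card P"
    unfolding P_def K(2)[symmetric] using finP by (intro card_mono) (auto simp: P_def)
  \<comment> \<open>All elements of the cosets other than \<open>H\<close> are vertices, while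
    \<open>H\<close> is represented by \<open>\<one>\<close> alone.\<close>
  define C where "C = insert \<one> (\<Union>(P - {H}))"
  have UG: "\<Union>(P - {H}) \<subseteq> carrier G"
    using PR rcosets_part_G[OF subgroup_axioms] by blast
  \<comment> \<open>Disjointness of cosets serves twice: it makes \<open>C\<close> a set of
    vertices, and it keeps \<open>\<one>\<close> out of the union, so that inserting it adds exactly
    1 to the size.\<close>
  have notH: "x \<notin> H" if "x \<in> A" "A \<in> P" "A \<noteq> H" for x A
  proof -
    have "A \<in> rcosets H" and "H \<in> rcosets H"
      using that(2) PR subgroup_in_rcosets[OF is_group] by auto
    then have "disjnt A H"
      using rcos_disjoint[OF subgroup_axioms] that(3) by (simp add: pairwise_def)
    then show ?thesis
      using that(1) by (auto simp: disjnt_def)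
  qed
  have CV: "C \<subseteq> nsb_verts G H"
    using UG notH by (auto simp: C_def nsb_verts_def)
  have CP: "H #> x \<in> P" if xC: "x \<in> C" for x
  proof (cases "x = \<one>")
    case True
    then show ?thesis
      using coset_join2[of \<one> H] subgroup_axioms by (simp add: P_def)
  next
    case False
    then obtain A where A: "x \<in> A" "A \<in> P"
      using xC by (auto simp: C_def)
    then obtain a where a: "a \<in> carrier G" "A = H #> a"
      using PR by (auto simp: RCOSETS_def)
    then have "H #> x = A"
      using A(1) repr_independence[of x H a] subgroup_axioms by simp
    then show ?thesis using A(2) by simp
  qed
  have "(x, y) \<in> parcs (nsb_power_graph G H)" if "x \<in> C" "y \<in> C" "x \<noteq> y" for x y
  proof -
    \<comment> \<open>Both cosets belong to the clique \<open>P\<close>, so they are either equal or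
      adjacent.\<close>
    have "H #> x = H #> y \<or> (H #> x, H #> y) \<in> parcs (power_graph (G Mod H))"
      using CP[OF that(1)] CP[OF that(2)] P by (auto simp: is_clique_def)
    then show ?thesis
      using that CV nsb_power_graph_arc_iff[of x y] by (simp add: subset_iff)
  qed
  then have "is_clique (nsb_power_graph G H) C"
    using CV by (simp add: is_clique_def nsb_power_graph_def)
  then have "card C \<le> clique_number (nsb_power_graph G H)"
    using assms
    by (intro card_clique_le_clique_number) (simp_all add: nsb_power_graph_def nsb_verts_def)
  moreover have "card C = card H * (card P - 1) + 1"
  proof -
    have "\<one> \<notin> \<Union>(P - {H})"
      using notH[of \<one>] by auto
    moreover have "card (\<Union>(P - {H})) = card H * (card P - 1)"
      using card_Union_rcosets_Diff[OF assms PR] by (simp add: P_def)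
    ultimately show ?thesis
      using finite_subset[OF UG assms] by (simp add: C_def)
  qed
  moreover have "card H * (clique_number (power_graph (G Mod H)) - 1) \<le> card H * (card P - 1)"
    using cardP by (simp add: diff_le_mono)
  ultimately show ?thesis by linarith
qed

text \<open>The singleton of \<open>\<one>\<close> is a clique. For the quotient this rules out
  truncation in the natural-number subtraction of 1, so the two bounds transfer to the
  integers.\<close>

lemma (in group) clique_number_power_graph_pos:
  assumes "finite (carrier G)"
  shows "clique_number (power_graph G) \<ge> 1"
  using card_clique_le_clique_number[of "power_graph G" "{\<one>}"] assms
  by (simp add: power_graph_def is_clique_def)

theorem theorem6p4:
  fixes G :: "('a, 'b) monoid_scheme" and H :: "'a set"
  assumes "group G" and "finite (carrier G)" and "H \<lhd> G"
  shows "int (clique_number (nsb_power_graph G H)) =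
    int (card H) * (int (clique_number (power_graph (G Mod H))) - 1) + 1"
proof -
  interpret normal H G by (rule assms(3))
  interpret Q: group "G Mod H" by (rule factorgroup_is_group)
  have "finite (carrier (G Mod H))"
    using assms(2) by (simp add: FactGroup_def RCOSETS_def)
  then have "clique_number (power_graph (G Mod H)) \<ge> 1"
    by (rule Q.clique_number_power_graph_pos)
  moreover have "clique_number (nsb_power_graph G H)
      = card H * (clique_number (power_graph (G Mod H)) - 1) + 1"
    using clique_number_nsb_power_graph_le[OF assms(2)]
      clique_number_nsb_power_graph_ge[OF assms(2)] by (rule antisym)
  ultimately show ?thesis
    by (simp add: of_nat_diff)
qed

end
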